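(* Let $\Gamma$ be a countable group and let $\varphi_o:\Gamma\to\mathbb{R}$ be a quasimorphism with $\varphi_o(e)=0$ which is not at bounded distance from a homomorphism $\Gamma\to\mathbb{R}$. If $P\subset\mathbb{R}$ is a closed subset such that $\mathbb{R}$ acts freely on $\Omega_P$, then $\Omega_{P(\varphi_o)}\cong\Delta_{\varphi_o}\times_c\Omega_P$ (a $(\Gamma\times\mathbb{R})$-equivariant homeomorphism), where $c:\Gamma\times\Delta_{\varphi_o}\to\mathbb{R}$ is given by $c(\gamma,\varphi)=\varphi(\gamma)$. In particular, $\Delta_{\varphi_o}$ is a continuous ($\Gamma$-equivariant) factor of $\Omega_{P(\varphi_o)}$.
   Context: $\varphi:\Gamma\to\mathbb{R}$ is a quasimorphism if $\sup_{g,h}|\varphi(gh)-\varphi(g)-\varphi(h)|<\infty$. Functions are at bounded distance if their difference is bounded. $\Gamma$ is discrete. $\mathscr{F}_o(\Gamma):=\{\varphi\in\mathbb{R}^\Gamma\mid\varphi(e)=0\}$ carries the product topology and the $\Gamma$-action $(\gamma.\varphi)(\gamma')=\varphi(\gamma'\gamma)-\varphi(\gamma)$; $\Delta_{\varphi_o}$ is the closure of the $\Gamma$-orbit of $\varphi_o$ in $\mathscr{F}_o(\Gamma)$. The twist of a closed $P\subset\mathbb{R}$ is $P(\varphi_o):=\{(\gamma,t)\in\Gamma\times\mathbb{R}\mid\varphi_o(\gamma)+t\in P\}$. For a locally compact second countable group $G$, $\mathscr{C}(G)$ is the space of closed subsets of $G$ with the Chabauty-Fell topology and action $g.Q:=Qg^{-1}$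 (so $t.Q=Q-t$ for $G=\mathbb{R}$); the hull $\Omega_Q$ of a closed $Q\subset G$ is the closure of its $G$-orbit in $\mathscr{C}(G)$. Thus $\Omega_P\subset\mathscr{C}(\mathbb{R})$ and $\Omega_{P(\varphi_o)}\subset\mathscr{C}(\Gamma\times\mathbb{R})$. Given a $\Gamma$-space $\Delta$, an $\mathbb{R}$-space $\Omega$ and a continuous cocycle $c:\Gamma\times\Delta\to\mathbb{R}$ (i.e. $c(\gamma_1\gamma_2,y)=c(\gamma_1,\gamma_2.y)+c(\gamma_2,y)$), $\Delta\times_c\Omega$ is $\Delta\times\Omega$ with the $(\Gamma\times\mathbb{R})$-action $(\gamma,t).(y,\omega):=(\gamma.y,(c(\gamma,y)+t).\omega)$. *)

theory Defs
  imports "HOL-Analysis.Analysis"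
begin

text \<open>
  Groups are types of class \<open>group_add\<close>, which is not assumed commutative: the product \<open>gh\<close>
  is written \<open>g + h\<close>, the unit \<open>e\<close> is \<open>0\<close>, and \<open>g h\<^sup>-\<^sup>1\<close> is \<open>g - h\<close>. The direct product
  \<open>\<Gamma> \<times> \<real>\<close> is the product type with its componentwise group structure and product topology.
\<close>

section \<open>Quasimorphisms\<close>

definition quasimorphism :: "('g::group_add \<Rightarrow> real) \<Rightarrow> bool" where
  "quasimorphism \<phi> \<longleftrightarrow> bdd_above (range (\<lambda>(g, h). \<bar>\<phi> (g + h) - \<phi> g - \<phi> h\<bar>))"

definition homomorphism :: "('g::group_add \<Rightarrow> real) \<Rightarrow> bool" where
  "homomorphism \<psi> \<longleftrightarrow> (\<forall>g h. \<psi> (g + h) = \<psi> g + \<psi> h)"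

definition at_bounded_distance :: "('g \<Rightarrow> real) \<Rightarrow> ('g \<Rightarrow> real) \<Rightarrow> bool" where
  "at_bounded_distance \<phi> \<psi> \<longleftrightarrow> bounded (range (\<lambda>g. \<phi> g - \<psi> g))"


section \<open>Spaces with a group action\<close>

definition continuous_action ::
    "('g::{topological_space,group_add} \<Rightarrow> 'x \<Rightarrow> 'x) \<Rightarrow> 'x topology \<Rightarrow> bool" where
  "continuous_action a X \<longleftrightarrow>
     continuous_map (prod_topology euclidean X) X (\<lambda>(g, x). a g x) \<and>
     (\<forall>x\<in>topspace X. a 0 x = x) \<and>
     (\<forall>g h. \<forall>x\<in>topspace X. a (g + h) x = a g (a h x))"

definition acts_freely :: "('g::group_add \<Rightarrow> 'x \<Rightarrow> 'x) \<Rightarrow> 'x set \<Rightarrow> bool" where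
  "acts_freely a S \<longleftrightarrow> (\<forall>x\<in>S. \<forall>g. a g x = x \<longrightarrow> g = 0)"

definition equivariant_on ::
    "'x set \<Rightarrow> ('g \<Rightarrow> 'x \<Rightarrow> 'x) \<Rightarrow> ('g \<Rightarrow> 'y \<Rightarrow> 'y) \<Rightarrow> ('x \<Rightarrow> 'y) \<Rightarrow> bool" where
  "equivariant_on S a b f \<longleftrightarrow> (\<forall>g. \<forall>x\<in>S. f (a g x) = b g (f x))"

definition isomorphic_spaces ::
    "('g::{topological_space,group_add} \<Rightarrow> 'x \<Rightarrow> 'x) \<Rightarrow> 'x topology \<Rightarrow>
     ('g \<Rightarrow> 'y \<Rightarrow> 'y) \<Rightarrow> 'y topology \<Rightarrow> bool" where
  "isomorphic_spaces a X b Y \<longleftrightarrow>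
     continuous_action a X \<and> continuous_action b Y \<and>
     (\<exists>f. homeomorphic_map X Y f \<and> equivariant_on (topspace X) a b f)"

definition continuous_factor ::
    "('g::{topological_space,group_add} \<Rightarrow> 'y \<Rightarrow> 'y) \<Rightarrow> 'y topology \<Rightarrow>
     ('g \<Rightarrow> 'x \<Rightarrow> 'x) \<Rightarrow> 'x topology \<Rightarrow> bool" where
  "continuous_factor b Y a X \<longleftrightarrow>
     continuous_action a X \<and> continuous_action b Y \<and>
     (\<exists>p. continuous_map X Y p \<and> p ` topspace X = topspace Y \<and>
          equivariant_on (topspace X) a b p)"

definition continuous_cocycle ::
    "('g::{topological_space,group_add} \<Rightarrow> 'y \<Rightarrow> 'y) \<Rightarrow> 'y topology \<Rightarrow>
     ('g \<Rightarrow> 'y \<Rightarrow> real) \<Rightarrow> bool" where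
  "continuous_cocycle a Y c \<longleftrightarrow>
     continuous_map (prod_topology euclidean Y) euclideanreal (\<lambda>(g, y). c g y) \<and>
     (\<forall>g h. \<forall>y\<in>topspace Y. c (g + h) y = c g (a h y) + c h y)"

definition twisted_product_action ::
    "('g \<Rightarrow> 'y \<Rightarrow> real) \<Rightarrow> ('g \<Rightarrow> 'y \<Rightarrow> 'y) \<Rightarrow> (real \<Rightarrow> 'w \<Rightarrow> 'w) \<Rightarrow>
     'g \<times> real \<Rightarrow> 'y \<times> 'w \<Rightarrow> 'y \<times> 'w" where
  "twisted_product_action c a b = (\<lambda>(g, t) (y, w). (a g y, b (c g y + t) w))"


section \<open>The orbit closure of a function\<close>

definition pointed_functions :: "('g::group_add \<Rightarrow> real) set" where
  "pointed_functions = {\<phi>. \<phi> 0 = 0}"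

definition function_action :: "'g::group_add \<Rightarrow> ('g \<Rightarrow> real) \<Rightarrow> 'g \<Rightarrow> real" where
  "function_action g \<phi> = (\<lambda>h. \<phi> (h + g) - \<phi> g)"

text \<open>The topology of the type \<^typ>\<open>'g \<Rightarrow> real\<close> is the product topology.\<close>

definition function_orbit_closure :: "('g::group_add \<Rightarrow> real) \<Rightarrow> ('g \<Rightarrow> real) set" where
  "function_orbit_closure \<phi> =
     (top_of_set pointed_functions) closure_of (range (\<lambda>g. function_action g \<phi>))"

abbreviation function_orbit_space :: "('g::group_add \<Rightarrow> real) \<Rightarrow> ('g \<Rightarrow> real) topology" where
  "function_orbit_space \<phi> \<equiv> top_of_set (function_orbit_closure \<phi>)"

definition evaluation_cocycle :: "'g \<Rightarrow> ('g \<Rightarrow> real) \<Rightarrow> real" where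
  "evaluation_cocycle g \<phi> = \<phi> g"

lemma continuous_cocycle_evaluation:
  fixes \<phi> :: "'g::{group_add,discrete_topology} \<Rightarrow> real"
  shows "continuous_cocycle function_action (function_orbit_space \<phi>) evaluation_cocycle"
proof -
  let ?Y = "function_orbit_space \<phi>"
  have "openin (prod_topology euclidean ?Y) {x \<in> UNIV \<times> topspace ?Y. (case x of (g, \<psi>) \<Rightarrow> \<psi> g) \<in> U}"
    if "open U" for U :: "real set"
  proof -
    have "continuous_map ?Y euclideanreal (\<lambda>\<psi>. \<psi> g)" for g
      unfolding continuous_map_iff_continuous
      by (rule continuous_on_subset[OF continuous_on_product_coordinates]) (rule subset_UNIV)
    then have 1: "openin ?Y {\<psi> \<in> topspace ?Y. \<psi> g \<in> U}" for g
      by (rule openin_continuous_map_preimage) (use that in \<open>simp only: open_openin\<close>)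
    have "openin (prod_topology euclidean ?Y) ({g} \<times> {\<psi> \<in> topspace ?Y. \<psi> g \<in> U})" for g
      unfolding openin_prod_Times_iff open_openin[symmetric]
      by (intro disjI2 conjI open_discrete 1)
    then have "openin (prod_topology euclidean ?Y)
        (\<Union>g. {g} \<times> {\<psi> \<in> topspace ?Y. \<psi> g \<in> U})"
      by (intro openin_Union) blast
    also have "(\<Union>g. {g} \<times> {\<psi> \<in> topspace ?Y. \<psi> g \<in> U})
        = {x \<in> UNIV \<times> topspace ?Y. (case x of (g, \<psi>) \<Rightarrow> \<psi> g) \<in> U}"
      by auto
    finally show ?thesis .
  qed
  then have "continuous_map (prod_topology euclidean ?Y) euclideanreal (\<lambda>(g, \<psi>). \<psi> g)"
    unfolding continuous_map_def topspace_prod_topology topspace_euclidean open_openin[symmetric]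
    by blast
  then show ?thesis
    unfolding continuous_cocycle_def evaluation_cocycle_def function_action_def
    by simp
qed


section \<open>The Chabauty-Fell topology and hulls\<close>

definition chabauty_fell :: "'a::topological_space set topology" where
  "chabauty_fell = topology_generated_by
     ({{Q. closed Q \<and> Q \<inter> K = {}} |K. compact K} \<union>
      {{Q. closed Q \<and> Q \<inter> U \<noteq> {}} |U. open U})"

lemma topspace_chabauty_fell: "topspace chabauty_fell = {Q. closed Q}"
proof
  show "topspace chabauty_fell \<subseteq> {Q :: 'a set. closed Q}"
    unfolding chabauty_fell_def topology_generated_by_topspace by blast
next
  have "{Q :: 'a set. closed Q \<and> Q \<inter> {} = {}} \<subseteq> topspace chabauty_fell"
    unfolding chabauty_fell_def topology_generated_by_topspace
    by (rule Union_upper, rule UnI1, rule CollectI, rule exI[of _ "{}"]) simp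
  then show "{Q :: 'a set. closed Q} \<subseteq> topspace chabauty_fell"
    by simp
qed

definition set_action :: "'a::group_add \<Rightarrow> 'a set \<Rightarrow> 'a set" where
  "set_action g Q = (\<lambda>x. x - g) ` Q"

definition set_hull :: "'a::{topological_space,group_add} set \<Rightarrow> 'a set set" where
  "set_hull Q = chabauty_fell closure_of (range (\<lambda>g. set_action g Q))"

abbreviation set_hull_space :: "'a::{topological_space,group_add} set \<Rightarrow> 'a set topology" where
  "set_hull_space Q \<equiv> subtopology chabauty_fell (set_hull Q)"

definition twist :: "real set \<Rightarrow> ('g \<Rightarrow> real) \<Rightarrow> ('g \<times> real) set" where
  "twist P \<phi> = {(g, t). \<phi> g + t \<in> P}"

lemma closed_twist:
  fixes \<phi> :: "'g::discrete_topology \<Rightarrow> real"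
  assumes "closed P"
  shows "closed (twist P \<phi>)"
proof -
  have "continuous_on UNIV (\<lambda>x. \<phi> (fst x) + snd x)"
    by (intro continuous_on_add continuous_on_snd continuous_on_id
        continuous_on_compose2[OF Topological_Spaces.continuous_on_discrete continuous_on_fst[OF continuous_on_id]])
      (rule subset_UNIV)
  then have "closed ((\<lambda>x. \<phi> (fst x) + snd x) -` P)"
    using assms by (simp add: closed_vimage)
  also have "(\<lambda>x. \<phi> (fst x) + snd x) -` P = twist P \<phi>"
    by (auto simp: twist_def)
  finally show ?thesis .
qed

end

theory Submission
  imports Defs
begin

text \<open>
  Write \<open>\<Delta>\<close> for the orbit closure of \<open>\<phi>\<close> and \<open>\<Omega>\<close> for the hull of \<open>P\<close>. The isomorphism is the inverse
  of the map \<open>(\<psi>, Q) \<mapsto> Q(\<psi>)\<close> from \<open>\<Delta> \<times> \<Omega>\<close> to the hull of \<open>P(\<phi>)\<close>, where \<open>Q(\<psi>)\<close> is the twist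
  (lemma \<open>homeomorphic_map_twist\<close>). This map is equivariant for the twisted product action by
  direct computation (\<open>twist_equivariant\<close>).

  It is injective because the slice of \<open>Q(\<psi>)\<close> over \<open>\<gamma>\<close> is the translate \<open>\<psi>(\<gamma>).Q\<close>: the slice over
  \<open>e\<close> recovers \<open>Q\<close> since \<open>\<psi>(e) = 0\<close>, and then freeness recovers \<open>\<psi>(\<gamma>)\<close> (\<open>twist_inject\<close>).

  It is continuous because all of the maps \<open>(\<gamma>, t) \<mapsto> \<psi>(\<gamma>) + t\<close> are open, locally uniformly in \<open>\<psi>\<close>,
  and \<open>Q(\<psi>)\<close> is the preimage of \<open>Q\<close> under this map (\<open>continuous_map_vimage_chabauty_fell\<close>).
  The space \<open>\<Delta>\<close> is compact since the translates of a quasimorphism stay at uniformly bounded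
  distance from it, and \<open>\<Omega>\<close> is compact since the Chabauty-Fell space is. As the Chabauty-Fell space of
  \<open>\<Gamma> \<times> \<real>\<close> is Hausdorff, the map is a homeomorphism onto its image, which is closed.

  The image is the whole hull of \<open>P(\<phi>)\<close>: the orbit of \<open>(\<phi>, P)\<close> is the product of the \<open>\<Gamma>\<close>-orbit of
  \<open>\<phi>\<close> and the \<open>\<real>\<close>-orbit of \<open>P\<close>, because \<open>(\<gamma>, t)\<close> translates \<open>P\<close> by \<open>\<phi>(\<gamma>) + t\<close> and \<open>t\<close> is
  arbitrary. So this orbit is dense in \<open>\<Delta> \<times> \<Omega>\<close>, and it is mapped onto the
  orbit of \<open>P(\<phi>)\<close> (\<open>image_twist_orbits\<close>). The factor map onto \<open>\<Delta>\<close> is the first coordinate.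
\<close>

section \<open>The Chabauty-Fell topology\<close>

lemma openin_chabauty_fell_miss:
  assumes "compact K"
  shows "openin chabauty_fell {Q. closed Q \<and> Q \<inter> K = {}}"
  unfolding chabauty_fell_def
  by (rule topology_generated_by_Basis) (use assms in blast)

lemma openin_chabauty_fell_hit:
  assumes "open U"
  shows "openin chabauty_fell {Q. closed Q \<and> Q \<inter> U \<noteq> {}}"
  unfolding chabauty_fell_def
  by (rule topology_generated_by_Basis) (use assms in blast)

lemma continuous_map_into_chabauty_fell:
  fixes f :: "'x \<Rightarrow> 'a::topological_space set"
  assumes "\<And>x. x \<in> topspace X \<Longrightarrow> closed (f x)"
    and "\<And>K. compact K \<Longrightarrow> openin X {x \<in> topspace X. f x \<inter> K = {}}"
    and "\<And>U. open U \<Longrightarrow> openin X {x \<in> topspace X. f x \<inter> U \<noteq> {}}"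
  shows "continuous_map X chabauty_fell f"
  unfolding chabauty_fell_def
proof (rule continuous_on_generated_topo)
  fix S :: "'a set set"
  assume "S \<in> {{Q. closed Q \<and> Q \<inter> K = {}} |K. compact K} \<union> {{Q. closed Q \<and> Q \<inter> U \<noteq> {}} |U. open U}"
  then consider K where "compact K" "S = {Q. closed Q \<and> Q \<inter> K = {}}"
    | U where "open U" "S = {Q. closed Q \<and> Q \<inter> U \<noteq> {}}"
    by blast
  then show "openin X (f -` S \<inter> topspace X)"
  proof cases
    case 1
    have "f -` S \<inter> topspace X = {x \<in> topspace X. f x \<inter> K = {}}"
      using assms(1) 1 by blast
    then show ?thesis using assms(2) 1 by simp
  next
    case 2
    have "f -` S \<inter> topspace X = {x \<in> topspace X. f x \<inter> U \<noteq> {}}"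
      using assms(1) 2 by blast
    then show ?thesis using assms(3) 2 by simp
  qed
next
  show "f ` topspace X \<subseteq> \<Union> ({{Q. closed Q \<and> Q \<inter> K = {}} |K. compact K} \<union>
      {{Q. closed Q \<and> Q \<inter> U \<noteq> {}} |U. open U})"
    unfolding topspace_chabauty_fell[unfolded chabauty_fell_def topology_generated_by_topspace]
    using assms(1) by blast
qed

lemma topology_generated_by_eq_subbase:
  "topology_generated_by \<B> =
     topology (arbitrary union_of (finite intersection_of (\<lambda>x. x \<in> \<B>) relative_to \<Union>\<B>))"
    (is "?X = ?Y")
proof (unfold topology_eq, intro allI iffI)
  fix S assume "openin ?X S"
  then have "generate_topology_on \<B> S"
    by (rule openin_topology_generated_by)
  then show "openin ?Y S"
  proof (rule generate_topology_on_coarsest[rotated 2])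
    show "istopology (openin ?Y)" by simp
    fix B assume "B \<in> \<B>"
    then have "(finite intersection_of (\<lambda>x. x \<in> \<B>) relative_to \<Union>\<B>) B"
      by (intro relative_to_subset_inc finite_intersection_of_inc) auto
    then show "openin ?Y B"
      unfolding openin_subbase by (rule arbitrary_union_of_inc)
  qed
next
  fix S assume "openin ?Y S"
  then show "openin ?X S"
    by (rule minimal_topology_subbase[rotated 2])
      (use openin_topspace[of ?X] in \<open>simp_all add: topology_generated_by_Basis\<close>)
qed

text \<open>
  No separation or local compactness is needed here. By Alexander's subbase theorem it suffices to
  consider covers by sets \<open>miss K = {Q. Q \<inter> K = {}}\<close> and \<open>hit U = {Q. Q \<inter> U \<noteq> {}}\<close>, with \<open>K\<close>
  compact and \<open>U\<close> open. The complement of the union of all the \<open>U\<close> that occur is a closed set that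
  lies in no \<open>hit U\<close> of the cover, hence in some \<open>miss K\<close>. This \<open>K\<close> is covered by finitely many of
  the \<open>U\<close>, and the corresponding \<open>hit U\<close> together with \<open>miss K\<close> cover the space.
\<close>
lemma compact_space_chabauty_fell:
  "compact_space (chabauty_fell :: 'a::topological_space set topology)"
proof -
  define miss where "miss K = {Q :: 'a set. closed Q \<and> Q \<inter> K = {}}" for K
  define hit where "hit U = {Q :: 'a set. closed Q \<and> Q \<inter> U \<noteq> {}}" for U
  define \<B> where "\<B> = {miss K |K. compact K} \<union> {hit U |U. open U}"
  have gen: "chabauty_fell = topology_generated_by \<B>"
    unfolding chabauty_fell_def \<B>_def miss_def hit_def ..
  have ts: "topspace chabauty_fell = {Q :: 'a set. closed Q}"
    by (rule topspace_chabauty_fell)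
  show ?thesis
  proof (rule Alexander_subbase)
    show "topology (arbitrary union_of (finite intersection_of (\<lambda>x. x \<in> \<B>) relative_to \<Union> \<B>)) = chabauty_fell"
      unfolding gen by (rule topology_generated_by_eq_subbase[symmetric])
  next
    fix C assume CB: "C \<subseteq> \<B>" and cov: "\<Union> C = topspace (chabauty_fell :: 'a set topology)"
    define \<U> where "\<U> = {U. open U \<and> hit U \<in> C}"
    have "closed (- \<Union>\<U>)"
      unfolding \<U>_def by (intro closed_Compl open_Union) blast
    then have "- \<Union>\<U> \<in> \<Union>C"
      unfolding cov ts by simp
    then obtain S where S: "S \<in> C" "- \<Union>\<U> \<in> S"
      by (elim UnionE)
    have "S \<noteq> hit U" if "open U" for U
      using S that unfolding \<U>_def hit_def by blast
    moreover have "S \<in> \<B>"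
      using S(1) CB by (rule subsetD[rotated])
    ultimately obtain K where K: "compact K" "S = miss K"
      unfolding \<B>_def by fast
    have "K \<subseteq> \<Union>\<U>"
      using S(2) unfolding K(2) miss_def by blast
    moreover have "\<And>U. U \<in> \<U> \<Longrightarrow> open U"
      unfolding \<U>_def by blast
    ultimately obtain \<V> where V: "\<V> \<subseteq> \<U>" "finite \<V>" "K \<subseteq> \<Union>\<V>"
      using K(1) by (meson compactE)
    let ?C = "insert S (hit ` \<V>)"
    have sub: "?C \<subseteq> C"
      using S(1) V(1) unfolding \<U>_def by blast
    have "Q \<in> \<Union>?C" if "closed Q" for Q
    proof (cases "Q \<inter> K = {}")
      case True
      then show ?thesis using that by (simp add: K(2) miss_def)
    next
      case False
      then obtain U where "U \<in> \<V>" "Q \<inter> U \<noteq> {}"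
        using V(3) by blast
      then show ?thesis using that by (auto simp: hit_def)
    qed
    then have top: "\<Union>?C = topspace chabauty_fell"
      using Union_mono[OF sub] unfolding cov ts by (intro equalityI subsetI) auto
    have "finite ?C"
      using V(2) by simp
    with sub top show "\<exists>C'. finite C' \<and> C' \<subseteq> C \<and> \<Union> C' = topspace (chabauty_fell :: 'a set topology)"
      by metis
  qed
qed

lemma compact_neighbourhood_disjoint:
  fixes K :: "'a::t2_space set"
  assumes "locally_compact_space (euclidean :: 'a topology)"
    and "compact K" "closed Q" "K \<inter> Q = {}"
  obtains V C where "open V" "compact C" "K \<subseteq> V" "V \<subseteq> C" "C \<inter> Q = {}"
proof -
  have haus: "Hausdorff_space (euclidean :: 'a topology)"
    by (metis (no_types) Hausdorff_space_def disjnt_def open_openin separation_t2)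
  obtain U L where UL: "open U" "compact L" "K \<subseteq> U" "U \<subseteq> L"
    using assms(1,2) unfolding locally_compact_space_compact_closed_compact[OF disjI1[OF haus]]
    by auto
  have "compact (L \<inter> Q)"
    using UL(2) assms(3) by (rule compact_Int_closed)
  then have "compactin euclidean (L \<inter> Q)"
    by (simp add: compactin_euclidean_iff)
  moreover have "compactin euclidean K" "disjnt K (L \<inter> Q)"
    using assms(2,4) by (auto simp: compactin_euclidean_iff disjnt_def)
  ultimately obtain A B where "openin euclidean A" "openin euclidean B" "K \<subseteq> A" "L \<inter> Q \<subseteq> B" "disjnt A B"
    using Hausdorff_space_compact_separation[OF haus] by metis
  then have AB: "open A" "open B" "K \<subseteq> A" "L \<inter> Q \<subseteq> B" "A \<inter> B = {}"
    by (simp_all add: disjnt_def)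
  show ?thesis
  proof (rule that[of "U \<inter> A" "L - B"])
    show "compact (L - B)"
      using UL(2) AB(2) by (rule compact_diff)
  qed (use UL AB in auto)
qed

lemma Hausdorff_space_chabauty_fell:
  assumes "locally_compact_space (euclidean :: 'a::t2_space topology)"
  shows "Hausdorff_space (chabauty_fell :: 'a set topology)"
proof -
  have sep: "\<exists>\<U> \<V>. openin chabauty_fell \<U> \<and> openin chabauty_fell \<V> \<and> Q \<in> \<U> \<and> R \<in> \<V> \<and> disjnt \<U> \<V>"
    if "closed Q" "closed R" "x \<in> Q" "x \<notin> R" for Q R :: "'a set" and x
  proof -
    have "{x} \<inter> R = {}" using that by simp
    then obtain V C where VC: "open V" "compact C" "{x} \<subseteq> V" "V \<subseteq> C" "C \<inter> R = {}"
      using compact_neighbourhood_disjoint[OF assms compact_sing \<open>closed R\<close>] by metis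
    show ?thesis
      by (rule exI[of _ "{Q. closed Q \<and> Q \<inter> V \<noteq> {}}"], rule exI[of _ "{Q. closed Q \<and> Q \<inter> C = {}}"])
        (use that VC in \<open>auto simp: disjnt_def openin_chabauty_fell_hit openin_chabauty_fell_miss\<close>)
  qed
  show ?thesis
    unfolding Hausdorff_space_def topspace_chabauty_fell
  proof (intro allI impI)
    fix Q R :: "'a set" assume QR: "Q \<in> {Q. closed Q} \<and> R \<in> {Q. closed Q} \<and> Q \<noteq> R"
    then consider x where "x \<in> Q" "x \<notin> R" | x where "x \<in> R" "x \<notin> Q" by blast
    then show "\<exists>\<U> \<V>. openin chabauty_fell \<U> \<and> openin chabauty_fell \<V> \<and> Q \<in> \<U> \<and> R \<in> \<V> \<and> disjnt \<U> \<V>"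
    proof cases
      case 1 then show ?thesis using sep QR by blast
    next
      case 2 then show ?thesis using sep[of R Q x] QR by (metis disjnt_sym mem_Collect_eq)
    qed
  qed
qed

text \<open>
  Translates and twists of closed sets are both preimages under a family of maps \<open>m t\<close>. The last
  hypothesis says that these maps are open, locally uniformly in \<open>t\<close>. It makes the condition
  \<open>m t -` Q \<inter> U \<noteq> {}\<close> open in \<open>(t, Q)\<close>; the condition \<open>m t -` Q \<inter> K = {}\<close> is open by the tube lemma
  and local compactness.
\<close>
lemma continuous_map_vimage_chabauty_fell:
  fixes m :: "'t \<Rightarrow> 'a::topological_space \<Rightarrow> 'b::t2_space"
  assumes lc: "locally_compact_space (euclidean :: 'b topology)"
    and cont: "continuous_map (prod_topology T euclidean) euclidean (\<lambda>(t, x). m t x)"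
    and opn: "\<And>t U x. t \<in> topspace T \<Longrightarrow> open U \<Longrightarrow> x \<in> U \<Longrightarrow>
      \<exists>W V. openin T W \<and> open V \<and> t \<in> W \<and> m t x \<in> V \<and> (\<forall>s\<in>W. V \<subseteq> m s ` U)"
  shows "continuous_map (prod_topology T chabauty_fell) chabauty_fell (\<lambda>(t, Q). m t -` Q)"
proof (rule continuous_map_into_chabauty_fell)
  have cont_t: "continuous_on UNIV (m t)" if "t \<in> topspace T" for t
  proof -
    have "continuous_map euclidean (prod_topology T euclidean) (\<lambda>x. (t, x :: 'a))"
      using that by (intro continuous_map_pairedI) auto
    from continuous_map_compose[OF this cont] show ?thesis
      by (simp add: o_def)
  qed
  show "closed (case z of (t, Q) \<Rightarrow> m t -` Q)" if "z \<in> topspace (prod_topology T chabauty_fell)" for z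
    using that cont_t by (auto simp: topspace_chabauty_fell intro!: closed_vimage)
  show "openin (prod_topology T chabauty_fell)
      {z \<in> topspace (prod_topology T chabauty_fell). (case z of (t, Q) \<Rightarrow> m t -` Q) \<inter> K = {}}"
    if K: "compact K" for K
    unfolding openin_prod_topology_alt
  proof (intro allI impI)
    fix t Q
    assume "(t, Q) \<in> {z \<in> topspace (prod_topology T chabauty_fell). (case z of (t, Q) \<Rightarrow> m t -` Q) \<inter> K = {}}"
    then have tQ: "t \<in> topspace T" "closed Q" "m t -` Q \<inter> K = {}"
      by (auto simp: topspace_chabauty_fell)
    have "compact (m t ` K)"
      using K cont_t[OF tQ(1)] by (meson compact_continuous_image continuous_on_subset subset_UNIV)
    moreover have "m t ` K \<inter> Q = {}"
      using tQ(3) by blast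
    ultimately obtain V C where VC: "open V" "compact C" "m t ` K \<subseteq> V" "V \<subseteq> C" "C \<inter> Q = {}"
      using compact_neighbourhood_disjoint[OF lc _ tQ(2)] by metis
    let ?W = "{z \<in> topspace (prod_topology T euclidean). (\<lambda>(t, x). m t x) z \<in> V}"
    have "openin (prod_topology T euclidean) ?W"
      using VC(1) by (intro openin_continuous_map_preimage[OF cont]) simp
    moreover have "{t} \<times> K \<subseteq> ?W"
      using VC(3) tQ(1) by auto
    ultimately obtain A B where AB: "openin T A" "t \<in> A" "K \<subseteq> B" "A \<times> B \<subseteq> ?W"
      using tube_lemma_right[of T euclidean ?W K t] K tQ(1) by auto
    show "\<exists>U V. openin T U \<and> openin chabauty_fell V \<and> t \<in> U \<and> Q \<in> V \<and>
        U \<times> V \<subseteq> {z \<in> topspace (prod_topology T chabauty_fell). (case z of (t, Q) \<Rightarrow> m t -` Q) \<inter> K = {}}"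
    proof (intro exI conjI)
      show "openin T A" "t \<in> A" by fact+
      show "openin chabauty_fell {Q. closed Q \<and> Q \<inter> C = {}}"
        by (rule openin_chabauty_fell_miss) fact
      show "Q \<in> {Q. closed Q \<and> Q \<inter> C = {}}" using tQ(2) VC(5) by auto
      have "m s -` R \<inter> K = {}" if "s \<in> A" "R \<inter> C = {}" for s R
      proof -
        have "m s x \<in> V" if "x \<in> K" for x
          using subsetD[OF AB(4), of "(s, x)"] AB(3) \<open>s \<in> A\<close> that by auto
        then show ?thesis using VC(4) \<open>R \<inter> C = {}\<close> by blast
      qed
      then show "A \<times> {Q. closed Q \<and> Q \<inter> C = {}}
          \<subseteq> {z \<in> topspace (prod_topology T chabauty_fell). (case z of (t, Q) \<Rightarrow> m t -` Q) \<inter> K = {}}"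
        using openin_subset[OF AB(1)] by (auto simp: topspace_chabauty_fell)
    qed
  qed
  show "openin (prod_topology T chabauty_fell)
      {z \<in> topspace (prod_topology T chabauty_fell). (case z of (t, Q) \<Rightarrow> m t -` Q) \<inter> U \<noteq> {}}"
    if U: "open U" for U
    unfolding openin_prod_topology_alt
  proof (intro allI impI)
    fix t Q
    assume "(t, Q) \<in> {z \<in> topspace (prod_topology T chabauty_fell). (case z of (t, Q) \<Rightarrow> m t -` Q) \<inter> U \<noteq> {}}"
    then obtain x where tQ: "t \<in> topspace T" "closed Q" "x \<in> U" "m t x \<in> Q"
      by (auto simp: topspace_chabauty_fell)
    obtain W V where WV: "openin T W" "open V" "t \<in> W" "m t x \<in> V" "\<forall>s\<in>W. V \<subseteq> m s ` U"
      using opn[OF tQ(1) U tQ(3)] by blast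
    show "\<exists>A B. openin T A \<and> openin chabauty_fell B \<and> t \<in> A \<and> Q \<in> B \<and>
        A \<times> B \<subseteq> {z \<in> topspace (prod_topology T chabauty_fell). (case z of (t, Q) \<Rightarrow> m t -` Q) \<inter> U \<noteq> {}}"
    proof (intro exI conjI)
      show "openin T W" "t \<in> W" by fact+
      show "openin chabauty_fell {Q. closed Q \<and> Q \<inter> V \<noteq> {}}"
        by (rule openin_chabauty_fell_hit) fact
      show "Q \<in> {Q. closed Q \<and> Q \<inter> V \<noteq> {}}" using tQ WV by auto
      have "m s -` R \<inter> U \<noteq> {}" if "s \<in> W" "R \<inter> V \<noteq> {}" for s R
      proof -
        obtain v where "v \<in> R" "v \<in> V"
          using \<open>R \<inter> V \<noteq> {}\<close> by blast
        moreover obtain u where "u \<in> U" "v = m s u"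
          using WV(5) \<open>s \<in> W\<close> \<open>v \<in> V\<close> by auto
        ultimately show ?thesis by auto
      qed
      then show "W \<times> {Q. closed Q \<and> Q \<inter> V \<noteq> {}}
          \<subseteq> {z \<in> topspace (prod_topology T chabauty_fell). (case z of (t, Q) \<Rightarrow> m t -` Q) \<inter> U \<noteq> {}}"
        using openin_subset[OF WV(1)] by (auto simp: topspace_chabauty_fell)
    qed
  qed
qed


section \<open>The action of a locally compact group on a hull\<close>

lemma set_action_eq_vimage: "set_action g Q = (\<lambda>x. x + g) -` Q"
  unfolding set_action_def by (force simp: image_iff)

lemma set_action_zero [simp]: "set_action 0 Q = Q"
  by (simp add: set_action_def)

lemma set_action_add: "set_action (g + h) Q = set_action g (set_action h Q)"
  by (simp add: set_action_eq_vimage vimage_def add.assoc)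

lemma compact_space_set_hull: "compact_space (set_hull_space Q)"
  unfolding set_hull_def
  by (intro compact_space_subtopology closedin_compact_space[OF compact_space_chabauty_fell] closedin_closure_of)

lemma topspace_set_hull: "topspace (set_hull_space Q) = set_hull Q"
  unfolding set_hull_def by (simp add: Int_absorb1 closure_of_subset_topspace)

text \<open>
  The assumptions say that the type is a locally compact Hausdorff group. Stated as
  formulas rather than by a type class, they apply to the product of a discrete group with \<open>\<real>\<close>.
\<close>
context
  assumes lc: "locally_compact_space (euclidean :: 'a::{t2_space,group_add} topology)"
    and cont_diff: "continuous_on UNIV (\<lambda>(x, y :: 'a). x - y)"
begin

lemma continuous_map_set_action:
  "continuous_map (prod_topology euclidean chabauty_fell) chabauty_fell
     (\<lambda>(g :: 'a, Q). set_action g Q)"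
proof -
  have diff: "continuous_on S (\<lambda>x. f x - g x)" if "continuous_on S f" "continuous_on S g"
    for S :: "('a \<times> 'a) set" and f g :: "'a \<times> 'a \<Rightarrow> 'a"
    using continuous_on_compose2[OF cont_diff continuous_on_Pair[OF that]] by simp
  \<comment> \<open>Addition is continuous since \<open>x + g = x - (0 - g)\<close>.\<close>
  have "continuous_on UNIV (\<lambda>z :: 'a \<times> 'a. snd z - (0 - fst z))"
    by (intro diff continuous_intros)
  then have add: "continuous_on UNIV (\<lambda>(g :: 'a, x). x + g)"
    by (simp add: case_prod_unfold)
  show ?thesis
    unfolding set_action_eq_vimage
  proof (rule continuous_map_vimage_chabauty_fell[OF lc])
    show "continuous_map (prod_topology euclidean euclidean) euclidean (\<lambda>(g :: 'a, x). x + g)"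
      using add by simp
    fix g x :: 'a and U :: "'a set"
    assume "open U" "x \<in> U"
    have "continuous_on UNIV (\<lambda>z :: 'a \<times> 'a. snd z - fst z)"
      by (intro diff continuous_intros)
    then have "open ((\<lambda>z :: 'a \<times> 'a. snd z - fst z) -` U)"
      using \<open>open U\<close> open_vimage by blast
    moreover have "(g, x + g) \<in> (\<lambda>z. snd z - fst z) -` U"
      using \<open>x \<in> U\<close> by simp
    ultimately obtain W V where WV: "open W" "open V" "(g, x + g) \<in> W \<times> V"
        "W \<times> V \<subseteq> (\<lambda>z. snd z - fst z) -` U"
      by (rule open_prod_elim)
    have "v \<in> (\<lambda>x. x + s) ` U" if "s \<in> W" "v \<in> V" for s v
      using WV(4) that by (intro image_eqI[of _ _ "v - s"]) auto
    then show "\<exists>W V. openin euclidean W \<and> open V \<and> g \<in> W \<and> x + g \<in> V \<and> (\<forall>s\<in>W. V \<subseteq> (\<lambda>x. x + s) ` U)"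
      using WV by (intro exI[of _ W] exI[of _ V]) auto
  qed
qed

lemma continuous_map_set_action_left: "continuous_map chabauty_fell chabauty_fell (set_action (g :: 'a))"
proof -
  have "continuous_map chabauty_fell (prod_topology euclidean chabauty_fell) (\<lambda>R. (g, R))"
    by (intro continuous_map_pairedI) auto
  from continuous_map_compose[OF this continuous_map_set_action] show ?thesis
    by (simp add: o_def)
qed

lemma orbit_subset_set_hull:
  assumes "closed (Q :: 'a set)"
  shows "range (\<lambda>g. set_action g Q) \<subseteq> set_hull Q"
  unfolding set_hull_def
proof (rule closure_of_subset)
  show "range (\<lambda>g. set_action g Q) \<subseteq> topspace chabauty_fell"
    using continuous_map_image_subset_topspace[OF continuous_map_set_action_left] assms
    by (auto simp: topspace_chabauty_fell)
qed

lemma set_action_in_set_hull: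
  fixes Q :: "'a set"
  assumes "R \<in> set_hull Q"
  shows "set_action g R \<in> set_hull Q"
proof -
  have "set_action g ` set_hull Q \<subseteq> chabauty_fell closure_of (set_action g ` range (\<lambda>h. set_action h Q))"
    unfolding set_hull_def by (rule continuous_map_image_closure_subset[OF continuous_map_set_action_left])
  also have "\<dots> \<subseteq> set_hull Q"
    unfolding set_hull_def by (intro closure_of_mono) (auto simp: set_action_add[symmetric])
  finally show ?thesis using assms by blast
qed

lemma continuous_action_set_hull:
  "continuous_action set_action (set_hull_space (Q :: 'a set))"
  unfolding continuous_action_def
proof (intro conjI ballI allI)
  show "continuous_map (prod_topology euclidean (set_hull_space Q)) (set_hull_space Q)
      (\<lambda>(g, x). set_action g x)"
    unfolding continuous_map_in_subtopology prod_topology_subtopology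
  proof
    show "continuous_map (subtopology (prod_topology euclidean chabauty_fell) (topspace euclidean \<times> set_hull Q))
       chabauty_fell (\<lambda>(g, x). set_action g x)"
      by (rule continuous_map_from_subtopology[OF continuous_map_set_action])
  qed (auto simp: set_action_in_set_hull)
qed (simp_all add: set_action_add)

end


section \<open>Twisted products\<close>

lemma continuous_action_twisted_product:
  fixes a :: "'g::{topological_space,group_add} \<Rightarrow> 'y \<Rightarrow> 'y" and b :: "real \<Rightarrow> 'w \<Rightarrow> 'w"
  assumes a: "continuous_action a Y" and b: "continuous_action b Z" and c: "continuous_cocycle a Y c"
  shows "continuous_action (twisted_product_action c a b) (prod_topology Y Z)"
proof -
  let ?D = "prod_topology (prod_topology euclidean euclidean) (prod_topology Y Z)
    :: (('g \<times> real) \<times> 'y \<times> 'w) topology"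
  have ca: "continuous_map (prod_topology euclidean Y) Y (\<lambda>(g, y). a g y)"
    and cb: "continuous_map (prod_topology euclidean Z) Z (\<lambda>(t, w). b t w)"
    and cc: "continuous_map (prod_topology euclidean Y) euclideanreal (\<lambda>(g, y). c g y)"
    using a b c by (simp_all add: continuous_action_def continuous_cocycle_def)
  have inY: "a g y \<in> topspace Y" if "y \<in> topspace Y" for g y
    using continuous_map_image_subset_topspace[OF ca] that by auto
  have ff: "continuous_map ?D euclidean (\<lambda>z. fst (fst z))"
    and sf: "continuous_map ?D euclidean (\<lambda>z. snd (fst z))"
    and fs: "continuous_map ?D Y (\<lambda>z. fst (snd z))"
    and ss: "continuous_map ?D Z (\<lambda>z. snd (snd z))"
    by (intro continuous_map_fst_of continuous_map_snd_of continuous_map_compose[OF continuous_map_fst, unfolded o_def]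
          continuous_map_compose[OF continuous_map_snd, unfolded o_def]
          continuous_map_fst continuous_map_snd)+
  have gy: "continuous_map ?D (prod_topology euclidean Y) (\<lambda>z. (fst (fst z), fst (snd z)))"
    using ff fs by (rule continuous_map_pairedI)
  have 1: "continuous_map ?D Y (\<lambda>z. a (fst (fst z)) (fst (snd z)))"
    using continuous_map_compose[OF gy ca] by (simp add: o_def)
  have "continuous_map ?D euclideanreal (\<lambda>z. c (fst (fst z)) (fst (snd z)))"
    using continuous_map_compose[OF gy cc] by (simp add: o_def)
  then have "continuous_map ?D euclideanreal (\<lambda>z. c (fst (fst z)) (fst (snd z)) + snd (fst z))"
    using sf by (rule continuous_map_add)
  then have "continuous_map ?D (prod_topology euclidean Z)
      (\<lambda>z. (c (fst (fst z)) (fst (snd z)) + snd (fst z), snd (snd z)))"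
    using ss by (rule continuous_map_pairedI)
  from continuous_map_compose[OF this cb]
  have 2: "continuous_map ?D Z (\<lambda>z. b (c (fst (fst z)) (fst (snd z)) + snd (fst z)) (snd (snd z)))"
    by (simp add: o_def)
  have "continuous_map (prod_topology euclidean (prod_topology Y Z)) (prod_topology Y Z)
      (\<lambda>(p, z). twisted_product_action c a b p z)"
    using continuous_map_pairedI[OF 1 2]
    by (simp add: twisted_product_action_def case_prod_unfold)
  moreover have "c 0 y = 0" if "y \<in> topspace Y" for y
  proof -
    have "c (0 + 0) y = c 0 (a 0 y) + c 0 y"
      using c that unfolding continuous_cocycle_def by blast
    then show ?thesis
      using a that by (simp add: continuous_action_def)
  qed
  moreover have "b (c (g + h) y + (t + s)) w = b (c g (a h y) + t) (b (c h y + s) w)"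
    if "y \<in> topspace Y" "w \<in> topspace Z" for g h y t s w
  proof -
    have "c (g + h) y + (t + s) = (c g (a h y) + t) + (c h y + s)"
      using c that by (simp add: continuous_cocycle_def)
    then show ?thesis
      using b that by (simp only: continuous_action_def)
  qed
  ultimately show ?thesis
    using a b by (auto simp: continuous_action_def twisted_product_action_def zero_prod_def)
qed


section \<open>Functions on a discrete group\<close>

lemma continuous_on_discrete_times:
  fixes f :: "'g::discrete_topology \<times> 'x::topological_space \<Rightarrow> 'y::topological_space"
  assumes "\<And>g. continuous_on UNIV (\<lambda>x. f (g, x))"
  shows "continuous_on UNIV f"
proof -
  have "open (f -` B)" if "open B" for B
  proof -
    have "f -` B = (\<Union>g. {g} \<times> (\<lambda>x. f (g, x)) -` B)"
      by auto
    moreover have "open ({g} \<times> (\<lambda>x. f (g, x)) -` B)" for g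
      by (intro open_Times open_discrete open_vimage that assms)
    ultimately show ?thesis by auto
  qed
  then show ?thesis
    by (simp add: continuous_on_open_vimage)
qed

lemma function_orbit_closure_eq_closure:
  "function_orbit_closure \<phi> = closure (range (\<lambda>g. function_action g \<phi>))"
proof -
  have cl: "closed (pointed_functions :: ('g::group_add \<Rightarrow> real) set)"
    unfolding pointed_functions_def
    by (intro closed_Collect_eq continuous_on_product_coordinates continuous_on_const)
  have sub: "range (\<lambda>g. function_action g \<phi>) \<subseteq> pointed_functions"
    by (auto simp: function_action_def pointed_functions_def)
  then have "closure (range (\<lambda>g. function_action g \<phi>)) \<subseteq> pointed_functions"
    using cl by (rule closure_minimal)
  then show ?thesis
    unfolding function_orbit_closure_def closure_of_subtopology
    using sub by (simp add: Int_absorb1 Int_absorb2 euclidean_closure_of)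
qed

lemma function_orbit_closure_zero:
  assumes "\<psi> \<in> function_orbit_closure \<phi>"
  shows "\<psi> 0 = 0"
  using assms closure_of_subset_topspace[of "top_of_set pointed_functions"]
  unfolding function_orbit_closure_def by (auto simp: pointed_functions_def)

lemma function_action_add: "function_action (g + h) \<phi> = function_action g (function_action h \<phi>)"
  by (simp add: function_action_def fun_eq_iff add.assoc)

lemma continuous_on_function_action: "continuous_on UNIV (function_action g)"
  unfolding function_action_def
  by (intro continuous_on_coordinatewise_then_product continuous_on_diff continuous_on_product_coordinates)

lemma function_action_in_function_orbit_closure:
  assumes "\<psi> \<in> function_orbit_closure \<phi>"
  shows "function_action g \<psi> \<in> function_orbit_closure \<phi>"
proof -
  have "function_action g ` function_orbit_closure \<phi> \<subseteq> function_orbit_closure \<phi>"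
    unfolding function_orbit_closure_eq_closure
  proof (rule image_closure_subset)
    show "continuous_on (closure (range (\<lambda>g. function_action g \<phi>))) (function_action g)"
      using continuous_on_function_action continuous_on_subset by blast
    show "function_action g ` range (\<lambda>g. function_action g \<phi>) \<subseteq> closure (range (\<lambda>g. function_action g \<phi>))"
      using closure_subset[of "range (\<lambda>g. function_action g \<phi>)"]
      by (auto simp: function_action_add[symmetric])
  qed simp
  then show ?thesis using assms by blast
qed

lemma continuous_action_function_orbit_space:
  fixes \<phi> :: "'g::{group_add,discrete_topology} \<Rightarrow> real"
  shows "continuous_action function_action (function_orbit_space \<phi>)"
  unfolding continuous_action_def
proof (intro conjI ballI allI)
  have "continuous_on UNIV (\<lambda>(g, \<psi> :: 'g \<Rightarrow> real). function_action g \<psi>)"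
    by (rule continuous_on_discrete_times) (simp add: continuous_on_function_action)
  then have "continuous_map (prod_topology euclidean euclidean) euclidean (\<lambda>(g, \<psi> :: 'g \<Rightarrow> real). function_action g \<psi>)"
    by simp
  then show "continuous_map (prod_topology euclidean (function_orbit_space \<phi>)) (function_orbit_space \<phi>)
     (\<lambda>(g, \<psi>). function_action g \<psi>)"
    unfolding continuous_map_in_subtopology prod_topology_subtopology
    by (auto intro: continuous_map_from_subtopology function_action_in_function_orbit_closure
          simp del: prod_topology_euclidean)
qed (simp_all add: function_action_add, simp add: function_action_def function_orbit_closure_zero)

text \<open>
  All translates of a quasimorphism \<open>\<phi>\<close> differ from \<open>\<phi>\<close> by at most its defect, so they lie in a
  product of compact intervals.
\<close>
lemma compact_function_orbit_closure:
  assumes "quasimorphism \<phi>"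
  shows "compact (function_orbit_closure \<phi>)"
proof -
  obtain D where D: "\<bar>\<phi> (g + h) - \<phi> g - \<phi> h\<bar> \<le> D" for g h
    using assms by (auto simp: quasimorphism_def bdd_above_def)
  define B where "B = Pi\<^sub>E UNIV (\<lambda>h. {\<phi> h - D .. \<phi> h + D})"
  have "compactin (product_topology (\<lambda>_. euclideanreal) UNIV) B"
    unfolding B_def compactin_PiE by (simp add: compactin_euclidean_iff)
  then have "compact B"
    by (simp add: euclidean_product_topology compactin_euclidean_iff)
  have "B = (\<Inter>h. (\<lambda>f. f h) -` {\<phi> h - D .. \<phi> h + D})"
    by (auto simp: B_def PiE_def Pi_def)
  then have "closed B"
    by (auto intro!: closed_INT closed_vimage continuous_on_product_coordinates)
  have "function_action g \<phi> \<in> B" for g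
  proof -
    have "function_action g \<phi> h \<in> {\<phi> h - D .. \<phi> h + D}" for h
      using D[of h g] by (simp add: function_action_def abs_le_iff)
    then show ?thesis by (simp add: B_def PiE_def Pi_def)
  qed
  then have "function_orbit_closure \<phi> \<subseteq> B"
    unfolding function_orbit_closure_eq_closure by (intro closure_minimal \<open>closed B\<close>) blast
  moreover have "closed (function_orbit_closure \<phi>)"
    by (simp add: function_orbit_closure_eq_closure)
  ultimately show ?thesis
    using compact_Int_closed[OF \<open>compact B\<close>] by (metis inf.absorb2)
qed


section \<open>Twists\<close>

lemma twist_eq_vimage: "twist Q \<psi> = (\<lambda>(g, t). \<psi> g + t) -` Q"
  by (auto simp: twist_def)

lemma twist_equivariant:
  "twist (set_action (\<psi> g + t) Q) (function_action g \<psi>) = set_action (g, t) (twist Q \<psi>)"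
  by (auto simp: twist_def set_action_eq_vimage function_action_def algebra_simps)

lemma slice_twist: "{t. (g, t) \<in> twist Q \<psi>} = set_action (\<psi> g) Q"
  by (auto simp: twist_def set_action_eq_vimage add.commute)

lemma twist_inject:
  assumes eq: "twist Q \<psi> = twist R \<theta>" and "\<psi> 0 = 0" "\<theta> 0 = 0"
    and free: "\<And>t. set_action t Q = Q \<Longrightarrow> t = 0"
  shows "\<psi> = \<theta> \<and> Q = R"
proof -
  have slices: "set_action (\<psi> g) Q = set_action (\<theta> g) R" for g
    using eq by (metis slice_twist)
  from slices[of 0] have "Q = R"
    using assms(2,3) by simp
  moreover have "\<psi> g = \<theta> g" for g
  proof -
    \<comment> \<open>Translating the two equal slices back by \<open>\<theta> g\<close> shows that \<open>\<psi> g - \<theta> g\<close> stabilises \<open>Q\<close>.\<close>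
    have "set_action (- \<theta> g + \<psi> g) Q = set_action (- \<theta> g + \<theta> g) Q"
      using slices[of g] \<open>Q = R\<close> by (simp only: set_action_add)
    then show ?thesis using free by fastforce
  qed
  ultimately show ?thesis by blast
qed

lemma continuous_on_diff_real: "continuous_on UNIV (\<lambda>(x, y :: real). x - y)"
  unfolding case_prod_unfold by (intro continuous_intros)

lemma locally_compact_space_discrete_times_real:
  "locally_compact_space (euclidean :: ('g::discrete_topology \<times> real) topology)"
proof -
  have "euclidean = discrete_topology (UNIV :: 'g set)"
    by (auto simp: topology_eq open_discrete)
  then show ?thesis
    unfolding prod_topology_euclidean[symmetric] locally_compact_space_prod_topology
    using locally_compact_space_discrete_topology locally_compact_space_euclidean by auto
qed

lemma continuous_on_diff_discrete_times_real:
  "continuous_on UNIV (\<lambda>(x, y :: 'g::{group_add,discrete_topology} \<times> real). x - y)"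
proof -
  have "continuous_on UNIV (\<lambda>(x, y :: 'g). x - y)"
    by (rule continuous_on_discrete_times) (simp add: Topological_Spaces.continuous_on_discrete)
  then have "continuous_on UNIV (\<lambda>z. case (fst (fst z), fst (snd z)) of (x, y :: 'g) \<Rightarrow> x - y)"
    by (rule continuous_on_compose2)
      (intro continuous_on_Pair continuous_on_fst continuous_on_snd continuous_on_id subset_UNIV)+
  then have "continuous_on UNIV (\<lambda>z :: ('g \<times> real) \<times> ('g \<times> real).
      (fst (fst z) - fst (snd z), snd (fst z) - snd (snd z)))"
    by (auto intro!: continuous_intros)
  then show ?thesis
    by (simp add: case_prod_unfold minus_prod_def)
qed

lemma continuous_map_twist:
  "continuous_map (prod_topology euclidean chabauty_fell) chabauty_fell
     (\<lambda>(\<psi> :: 'g::discrete_topology \<Rightarrow> real, Q). twist Q \<psi>)"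
  unfolding twist_eq_vimage
proof (rule continuous_map_vimage_chabauty_fell[OF locally_compact_space_euclidean])
  \<comment> \<open>With the discrete variable in front, continuity can be checked for each \<open>g\<close> separately.\<close>
  have "continuous_on UNIV (\<lambda>(g, \<psi> :: 'g \<Rightarrow> real, t). \<psi> g + t)"
  proof (rule continuous_on_discrete_times)
    fix g :: 'g
    have "continuous_on UNIV (\<lambda>z :: ('g \<Rightarrow> real) \<times> real. fst z g + snd z)"
      by (intro continuous_on_add continuous_on_snd continuous_on_id
            continuous_on_product_then_coordinatewise[OF continuous_on_fst])
    then show "continuous_on UNIV (\<lambda>z. case (g, z) of (g, \<psi> :: 'g \<Rightarrow> real, t) \<Rightarrow> \<psi> g + t)"
      by (simp add: case_prod_unfold)
  qed
  then have "continuous_on UNIV (\<lambda>z. case (fst (snd z), fst z, snd (snd z)) of (g, \<psi> :: 'g \<Rightarrow> real, t) \<Rightarrow> \<psi> g + t)"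
    by (rule continuous_on_compose2)
      (intro continuous_on_Pair continuous_on_fst continuous_on_snd continuous_on_id subset_UNIV)+
  then show "continuous_map (prod_topology euclidean euclidean) euclidean
      (\<lambda>(\<psi> :: 'g \<Rightarrow> real, x). case x of (g, t) \<Rightarrow> \<psi> g + t)"
    by (simp add: case_prod_unfold)
next
  fix \<psi> :: "'g \<Rightarrow> real" and U :: "('g \<times> real) set" and x
  assume "open U" "x \<in> U"
  obtain g t where x: "x = (g, t)" by fastforce
  \<comment> \<open>A section of all the maps at once: \<open>?n (\<theta>, y)\<close> is the point over \<open>g\<close> sent to \<open>y\<close> by \<open>\<theta>\<close>.\<close>
  let ?n = "\<lambda>z :: ('g \<Rightarrow> real) \<times> real. (g, snd z - fst z g)"
  have "continuous_on UNIV ?n"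
    by (intro continuous_on_Pair continuous_on_diff continuous_on_const continuous_on_snd continuous_on_id
          continuous_on_product_then_coordinatewise[OF continuous_on_fst])
  then have "open (?n -` U)"
    using \<open>open U\<close> open_vimage by blast
  moreover have "(\<psi>, \<psi> g + t) \<in> ?n -` U"
    using \<open>x \<in> U\<close> x by simp
  ultimately obtain W V where WV: "open W" "open V" "(\<psi>, \<psi> g + t) \<in> W \<times> V" "W \<times> V \<subseteq> ?n -` U"
    by (rule open_prod_elim)
  have "v \<in> (\<lambda>(g, t). \<theta> g + t) ` U" if "\<theta> \<in> W" "v \<in> V" for \<theta> v
    using WV(4) that by (intro image_eqI[of _ _ "(g, v - \<theta> g)"]) auto
  then show "\<exists>W V. openin euclidean W \<and> open V \<and> \<psi> \<in> W \<and> (case x of (g, t) \<Rightarrow> \<psi> g + t) \<in> V \<and>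
      (\<forall>\<theta>\<in>W. V \<subseteq> (\<lambda>(g, t). \<theta> g + t) ` U)"
    using WV x by (intro exI[of _ W] exI[of _ V]) auto
qed

section \<open>The hull of a twist\<close>

text \<open>
  The \<open>\<Gamma> \<times> \<real>\<close>-orbit of \<open>(\<phi>, P)\<close> in the twisted product consists of the pairs
  \<open>(\<gamma>.\<phi>, (\<phi>(\<gamma>) + t).P)\<close>; since \<open>t\<close> is arbitrary, it is the full product of the two orbits, and the twist
  maps it onto the orbit of \<open>P(\<phi>)\<close>.
\<close>
lemma image_twist_orbits:
  "(\<lambda>(\<psi>, Q). twist Q \<psi>) ` (range (\<lambda>g. function_action g \<phi>) \<times> range (\<lambda>t. set_action t P))
     = range (\<lambda>p. set_action p (twist P \<phi>))"
proof (intro equalityI subsetI)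
  fix R assume "R \<in> (\<lambda>(\<psi>, Q). twist Q \<psi>) ` (range (\<lambda>g. function_action g \<phi>) \<times> range (\<lambda>t. set_action t P))"
  then obtain g t where "R = twist (set_action t P) (function_action g \<phi>)" by auto
  then have "R = set_action (g, t - \<phi> g) (twist P \<phi>)"
    using twist_equivariant[of \<phi> g "t - \<phi> g" P] by simp
  then show "R \<in> range (\<lambda>p. set_action p (twist P \<phi>))" by blast
next
  fix R assume "R \<in> range (\<lambda>p. set_action p (twist P \<phi>))"
  then obtain g t where "R = set_action (g, t) (twist P \<phi>)" by auto
  then have "R = (\<lambda>(\<psi>, Q). twist Q \<psi>) (function_action g \<phi>, set_action (\<phi> g + t) P)"
    by (simp add: twist_equivariant)
  then show "R \<in> (\<lambda>(\<psi>, Q). twist Q \<psi>) ` (range (\<lambda>g. function_action g \<phi>) \<times> range (\<lambda>t. set_action t P))"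
    by blast
qed

lemma homeomorphic_map_twist:
  fixes \<phi> :: "'g::{group_add,discrete_topology} \<Rightarrow> real"
  assumes "quasimorphism \<phi>" and "closed P" and free: "acts_freely set_action (set_hull P)"
  shows "homeomorphic_map (prod_topology (function_orbit_space \<phi>) (set_hull_space P))
           (set_hull_space (twist P \<phi>)) (\<lambda>(\<psi>, Q). twist Q \<psi>)"
    (is "homeomorphic_map ?X ?Y ?F")
proof -
  let ?T = "prod_topology (euclidean :: ('g \<Rightarrow> real) topology) (chabauty_fell :: real set topology)"
  let ?S = "function_orbit_closure \<phi> \<times> set_hull P"
  have X: "?X = subtopology ?T ?S"
    by (simp add: subtopology_Times)
  have tX: "topspace ?X = ?S"
    by (simp add: topspace_set_hull del: topspace_subtopology)
  have compX: "compact_space ?X"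
    using compact_function_orbit_closure[OF assms(1)] compact_space_set_hull[of P]
    by (auto simp: compact_space_prod_topology compact_space_subtopology compactin_euclidean_iff)
  have haus: "Hausdorff_space (chabauty_fell :: ('g \<times> real) set topology)"
    by (rule Hausdorff_space_chabauty_fell[OF locally_compact_space_discrete_times_real])
  have cont: "continuous_map ?X chabauty_fell ?F"
    unfolding X by (rule continuous_map_from_subtopology[OF continuous_map_twist])
  have cl: "?S = ?T closure_of (range (\<lambda>g. function_action g \<phi>) \<times> range (\<lambda>t. set_action t P))"
    by (simp add: closure_of_Times function_orbit_closure_eq_closure set_hull_def euclidean_closure_of)
  have image: "?F ` ?S = set_hull (twist P \<phi>)"
  proof
    show "?F ` ?S \<subseteq> set_hull (twist P \<phi>)"
      unfolding cl unfolding set_hull_def image_twist_orbits[symmetric]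
      by (rule continuous_map_image_closure_subset[OF continuous_map_twist])
    have "compactin chabauty_fell (?F ` ?S)"
      using image_compactin[OF _ cont] compX tX unfolding compact_space_def by metis
    then have "closedin chabauty_fell (?F ` ?S)"
      using haus compactin_imp_closedin by blast
    moreover have "range (\<lambda>p. set_action p (twist P \<phi>)) \<subseteq> ?F ` ?S"
      unfolding image_twist_orbits[symmetric]
      using closure_subset[of "range (\<lambda>g. function_action g \<phi>)"]
        orbit_subset_set_hull[OF locally_compact_space_euclidean continuous_on_diff_real assms(2)]
      by (intro image_mono Sigma_mono) (auto simp: function_orbit_closure_eq_closure)
    ultimately show "set_hull (twist P \<phi>) \<subseteq> ?F ` ?S"
      unfolding set_hull_def[of "twist P \<phi>"] by (intro closure_of_minimal)
  qed
  show ?thesis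
  proof (rule continuous_imp_homeomorphic_map)
    show "continuous_map ?X ?Y ?F"
      unfolding continuous_map_in_subtopology using cont image tX by auto
    show "compact_space ?X" by (rule compX)
    show "Hausdorff_space ?Y" using haus by (rule Hausdorff_space_subtopology)
    show "?F ` topspace ?X = topspace ?Y"
      unfolding tX image topspace_set_hull ..
    show "inj_on ?F (topspace ?X)"
      unfolding tX
    proof (rule inj_onI, clarify)
      fix \<psi> \<theta> Q R
      assume *: "\<psi> \<in> function_orbit_closure \<phi>" "\<theta> \<in> function_orbit_closure \<phi>"
        "Q \<in> set_hull P" "R \<in> set_hull P" "twist Q \<psi> = twist R \<theta>"
      show "\<psi> = \<theta> \<and> Q = R"
        using *(5) function_orbit_closure_zero[OF *(1)] function_orbit_closure_zero[OF *(2)]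
        by (rule twist_inject) (use free *(3) in \<open>auto simp: acts_freely_def\<close>)
    qed
  qed
qed

lemma isomorphic_spaces_twist:
  fixes \<phi> :: "'g::{group_add,discrete_topology} \<Rightarrow> real"
  assumes "quasimorphism \<phi>" and "closed P" and "acts_freely set_action (set_hull P)"
  shows "isomorphic_spaces
           set_action (set_hull_space (twist P \<phi>))
           (twisted_product_action evaluation_cocycle function_action set_action)
           (prod_topology (function_orbit_space \<phi>) (set_hull_space P))"
    (is "isomorphic_spaces _ ?Y ?b ?X")
proof -
  let ?F = "\<lambda>(\<psi>, Q). twist Q \<psi>"
  have b: "continuous_action ?b ?X"
    by (intro continuous_action_twisted_product continuous_action_function_orbit_space
          continuous_action_set_hull locally_compact_space_euclidean continuous_on_diff_real
          continuous_cocycle_evaluation)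
  have a: "continuous_action set_action ?Y"
    by (intro continuous_action_set_hull locally_compact_space_discrete_times_real
          continuous_on_diff_discrete_times_real)
  obtain f where "homeomorphic_maps ?X ?Y ?F f"
    using homeomorphic_map_twist[OF assms] unfolding homeomorphic_map_maps by blast
  then have f: "homeomorphic_maps ?Y ?X f ?F"
    by (rule iffD1[OF homeomorphic_maps_sym])
  have cont_f: "continuous_map ?Y ?X f"
    using f unfolding homeomorphic_maps_def by (elim conjE)
  have F_f: "\<forall>R\<in>topspace ?Y. ?F (f R) = R"
    using f unfolding homeomorphic_maps_def by (elim conjE)
  have f_F: "\<forall>z\<in>topspace ?X. f (?F z) = z"
    using f unfolding homeomorphic_maps_def by (elim conjE)
  have "equivariant_on (topspace ?Y) set_action ?b f"
    unfolding equivariant_on_def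
  proof (intro allI ballI)
    fix p :: "'g \<times> real" and R
    assume R: "R \<in> topspace ?Y"
    obtain g t where p: "p = (g, t)" by fastforce
    obtain \<psi> Q where fR: "f R = (\<psi>, Q)" by fastforce
    have in_X: "f R \<in> topspace ?X"
      using continuous_map_image_subset_topspace[OF cont_f] R by (rule subsetD[OF _ imageI])
    have "?F (f R) = R"
      using F_f R by (rule bspec)
    then have "set_action p R = ?F (?b p (f R))"
      by (simp add: p fR twisted_product_action_def evaluation_cocycle_def twist_equivariant)
    moreover have "continuous_map (prod_topology euclidean ?X) ?X (\<lambda>(p, z). ?b p z)"
      using b unfolding continuous_action_def by (elim conjE)
    then have "(\<lambda>(p, z). ?b p z) (p, f R) \<in> topspace ?X"
      by (rule subsetD[OF continuous_map_image_subset_topspace imageI])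
        (use in_X in \<open>simp only: topspace_prod_topology topspace_euclidean mem_Sigma_iff UNIV_I simp_thms\<close>)
    then have "f (?F (?b p (f R))) = ?b p (f R)"
      using f_F by (simp only: prod.case)
    ultimately show "f (set_action p R) = ?b p (f R)"
      by (simp only:)
  qed
  moreover have "homeomorphic_map ?Y ?X f"
    using f homeomorphic_map_maps by blast
  ultimately show ?thesis
    using a b unfolding isomorphic_spaces_def by blast
qed

theorem proposition1p9:
  fixes \<phi>\<^sub>o :: "'g::{group_add,countable,discrete_topology} \<Rightarrow> real"
    and P :: "real set"
  assumes "quasimorphism \<phi>\<^sub>o"
    and "\<phi>\<^sub>o 0 = 0"
    and "\<not> (\<exists>\<psi>. homomorphism \<psi> \<and> at_bounded_distance \<phi>\<^sub>o \<psi>)"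
    and "closed P"
    and "acts_freely set_action (set_hull P)"
  shows "isomorphic_spaces
           set_action
           (set_hull_space (twist P \<phi>\<^sub>o))
           (twisted_product_action evaluation_cocycle function_action set_action)
           (prod_topology (function_orbit_space \<phi>\<^sub>o) (set_hull_space P)) \<and>
         continuous_factor
           function_action
           (function_orbit_space \<phi>\<^sub>o)
           (\<lambda>\<gamma>. set_action (\<gamma>, 0))
           (set_hull_space (twist P \<phi>\<^sub>o))"
proof
  let ?Y = "set_hull_space (twist P \<phi>\<^sub>o)"
  let ?\<Delta> = "function_orbit_space \<phi>\<^sub>o"
  let ?b = "twisted_product_action evaluation_cocycle function_action set_action"
  show iso: "isomorphic_spaces set_action ?Y ?b (prod_topology ?\<Delta> (set_hull_space P))"
    using assms(1,4,5) by (rule isomorphic_spaces_twist)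
  then obtain f where a: "continuous_action set_action ?Y"
    and f: "homeomorphic_map ?Y (prod_topology ?\<Delta> (set_hull_space P)) f"
    and eq: "equivariant_on (topspace ?Y) set_action ?b f"
    unfolding isomorphic_spaces_def by blast
  have act: "continuous_map (prod_topology euclidean ?Y) ?Y (\<lambda>(p, R). set_action p R)"
    using a by (simp add: continuous_action_def)
  have "continuous_map (prod_topology euclidean ?Y) euclideanreal (\<lambda>z :: 'g \<times> _. 0)"
    by (rule continuous_map_canonical_const)
  from continuous_map_pairedI[OF continuous_map_fst this]
  have "continuous_map (prod_topology euclidean ?Y) euclidean (\<lambda>z :: 'g \<times> _. (fst z, 0 :: real))"
    unfolding prod_topology_euclidean .
  then have "continuous_map (prod_topology euclidean ?Y) (prod_topology euclidean ?Y)
      (\<lambda>z :: 'g \<times> _. ((fst z, 0 :: real), snd z))"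
    using continuous_map_snd by (rule continuous_map_pairedI)
  from continuous_map_compose[OF this act]
  have "continuous_map (prod_topology euclidean ?Y) ?Y (\<lambda>(\<gamma>, R). set_action (\<gamma>, 0) R)"
    by (simp add: o_def case_prod_unfold)
  then have a0: "continuous_action (\<lambda>\<gamma>. set_action (\<gamma>, 0)) ?Y"
    unfolding continuous_action_def
    by (simp add: zero_prod_def[symmetric] set_action_add[symmetric])
  have p: "continuous_map ?Y ?\<Delta> (fst \<circ> f)"
    using homeomorphic_imp_continuous_map[OF f] continuous_map_fst by (rule continuous_map_compose)
  \<comment> \<open>The first projection is onto because the hull of \<open>P\<close> is nonempty: it contains \<open>P\<close>.\<close>
  have "P \<in> range (\<lambda>t. set_action t P)"
    by (rule range_eqI[of _ _ 0]) simp
  then have "P \<in> set_hull P"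
    using orbit_subset_set_hull[OF locally_compact_space_euclidean continuous_on_diff_real assms(4)] by blast
  then have "(fst \<circ> f) ` topspace ?Y = topspace ?\<Delta>"
    unfolding image_comp[symmetric] homeomorphic_imp_surjective_map[OF f]
    by (auto simp: topspace_set_hull fst_image_times simp del: topspace_subtopology)
  moreover have "equivariant_on (topspace ?Y) (\<lambda>\<gamma>. set_action (\<gamma>, 0)) function_action (fst \<circ> f)"
    using eq by (auto simp: equivariant_on_def twisted_product_action_def split: prod.splits)
  ultimately show "continuous_factor function_action ?\<Delta> (\<lambda>\<gamma>. set_action (\<gamma>, 0)) ?Y"
    using a0 p continuous_action_function_orbit_space unfolding continuous_factor_def by blast
qed

end
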